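(* Let $f:\mathbb{R}^n\to\mathbb{R}$ be such that there are a finite set $I$ and $C^3$ functions $f_k:\mathbb{R}^n\to\mathbb{R}$, $k\in I$, with $f(x)=\max_{k\in I} f_k(x)$ for all $x\in\mathbb{R}^n$, and assume that $f$ is $C^2$ at every point at which it is differentiable. Then for every bounded set $U\subseteq\mathbb{R}^n$ and every $\varepsilon'>0$ there is some $K>0$ such that $$\max_{z\in B_\varepsilon(x)} R_{x,\varepsilon}(z)\le K\varepsilon^3\qquad\forall x\in U,\ \varepsilon\in(0,\varepsilon'].$$
   Context: $B_\delta(x)=\{y\in\mathbb{R}^n:\|x-y\|\le\delta\}$ (Euclidean norm). $f$ is $C^2$ at a point if it is twice continuously differentiable on an open neighborhood of that point. $\Omega^2$ is the set of points at which $f$ is not twice differentiable. The second-order $\varepsilon$-jet of $f$ at $x$ ($\varepsilon\ge0$) is $$\mathcal{J}^2_\varepsilon f(x)=\bigcap_{\delta>\varepsilon}\overline{\{(y,f(y),\nabla f(y),\nabla^2 f(y)): y\in B_\delta(x)\setminus\Omega^2\}}\subseteq\mathbb{R}^n\times\mathbb{R}\times\mathbb{R}^n\times\mathbb{R}^{n\times n}.$$ The model of $f$ and its error are $$\mathcal{T}_{x,\varepsilon}(z)=\max_{(y,f(y),\xi,\mathcal{H})\in \mathcal{J}^2_\varepsilon f(x)} f(y)+\xi^\top(z-y)+\tfrac12(z-y)^\top\mathcal{H}(z-y),\qquad R_{x,\varepsilon}(z)=\mathcal{T}_{x,\varepsilon}(z)-f(z).$$ *)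

theory Defs
  imports "HOL-Analysis.Analysis"
begin

definition grad :: "(real ^ 'n \<Rightarrow> real) \<Rightarrow> real ^ 'n \<Rightarrow> real ^ 'n" where
  "grad f x = (THE g. GDERIV f x :> g)"

definition hess :: "(real ^ 'n \<Rightarrow> real) \<Rightarrow> real ^ 'n \<Rightarrow> real ^ 'n ^ 'n" where
  "hess f x = jacobian (grad f) (at x)"

(* Intended for open S: derivatives are taken in the full space, not relative to S. *)
fun C_k_on :: "nat \<Rightarrow> (real ^ 'n \<Rightarrow> real) \<Rightarrow> (real ^ 'n) set \<Rightarrow> bool" where
  "C_k_on 0 f S \<longleftrightarrow> continuous_on S f"
| "C_k_on (Suc k) f S \<longleftrightarrow>
     (\<forall>x\<in>S. f differentiable (at x)) \<and> (\<forall>i. C_k_on k (\<lambda>x. grad f x $ i) S)"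

definition C2_at :: "(real ^ 'n \<Rightarrow> real) \<Rightarrow> real ^ 'n \<Rightarrow> bool" where
  "C2_at f x \<longleftrightarrow> (\<exists>S. open S \<and> x \<in> S \<and> C_k_on 2 f S)"

definition twice_differentiable_at :: "(real ^ 'n \<Rightarrow> real) \<Rightarrow> real ^ 'n \<Rightarrow> bool" where
  "twice_differentiable_at f x \<longleftrightarrow>
     (\<forall>\<^sub>F y in nhds x. f differentiable (at y)) \<and> grad f differentiable (at x)"

definition Omega2 :: "(real ^ 'n \<Rightarrow> real) \<Rightarrow> (real ^ 'n) set" where
  "Omega2 f = {x. \<not> twice_differentiable_at f x}"

definition jet2 ::
  "real \<Rightarrow> (real ^ 'n \<Rightarrow> real) \<Rightarrow> real ^ 'n \<Rightarrow> ((real ^ 'n) \<times> real \<times> (real ^ 'n) \<times> (real ^ 'n ^ 'n)) set" where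
  "jet2 \<epsilon> f x = (\<Inter>\<delta>\<in>{\<epsilon><..}. closure ((\<lambda>y. (y, f y, grad f y, hess f y)) ` (cball x \<delta> - Omega2 f)))"

(* Maxima over infinite sets of reals are written with GREATEST, the greatest element
   (Max is only meaningful on finite sets, and Sup need not be attained). *)
definition model :: "(real ^ 'n \<Rightarrow> real) \<Rightarrow> real ^ 'n \<Rightarrow> real \<Rightarrow> real ^ 'n \<Rightarrow> real" where
  "model f x \<epsilon> z = (GREATEST t. t \<in>
     {f y + \<xi> \<bullet> (z - y) + 1 / 2 * ((z - y) \<bullet> (H *v (z - y))) | y \<xi> H. (y, f y, \<xi>, H) \<in> jet2 \<epsilon> f x})"

definition model_error :: "(real ^ 'n \<Rightarrow> real) \<Rightarrow> real ^ 'n \<Rightarrow> real \<Rightarrow> real ^ 'n \<Rightarrow> real" where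
  "model_error f x \<epsilon> z = model f x \<epsilon> z - f z"

end

theory Submission
  imports Defs
begin

text \<open>The finitely many closed sets on which \<open>f\<close> agrees with some \<open>f\<^sub>k\<close> cover the space, so their
  interiors have dense union, and there the 2-jet of \<open>f\<close> is that of \<open>f\<^sub>k\<close>. By continuity every element
  of the \<open>\<epsilon>\<close>-jet at \<open>x\<close> is the 2-jet of some \<open>f\<^sub>k\<close> at a point \<open>y\<close> within \<open>\<epsilon>\<close> of \<open>x\<close> at which \<open>f y = f\<^sub>k y\<close>.
  Taylor's theorem for \<open>f\<^sub>k\<close>, together with \<open>f\<^sub>k \<le> f\<close>, then bounds the error by a constant times
  \<open>(2\<epsilon>)\<^sup>3\<close>. Since \<open>GREATEST\<close> says nothing about sets without a greatest element, both maxima also have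
  to be shown to be attained; this follows from compactness of the \<open>\<epsilon>\<close>-jet.\<close>

section \<open>Gradients, Hessians and their locality\<close>

text \<open>\<open>grad\<close> is a definite description, so existence and uniqueness both matter:
  linearity of the derivative produces the vector with coordinates \<open>D (axis i 1)\<close>, and
  inner products determine a vector.\<close>

lemma GDERIV_grad:
  fixes f :: "real ^ 'n \<Rightarrow> real"
  assumes "f differentiable (at x)"
  shows "GDERIV f x :> grad f x"
proof -
  obtain D where D: "(f has_derivative D) (at x)"
    using assms by (auto simp: differentiable_def)
  then interpret bounded_linear D
    by (rule has_derivative_bounded_linear)
  define g :: "real ^ 'n" where "g = (\<chi> i. D (axis i 1))"
  have "D = (\<lambda>h. h \<bullet> g)"
  proof
    fix h
    have "D h = D (\<Sum>i\<in>UNIV. h $ i *\<^sub>R axis i 1)"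
      using basis_expansion[of h] by (simp add: scalar_mult_eq_scaleR)
    then show "D h = h \<bullet> g"
      by (simp add: sum scaleR g_def inner_vec_def)
  qed
  then have g: "GDERIV f x :> g"
    using D by (simp add: gderiv_def)
  have "g' = g" if "GDERIV f x :> g'" for g'
  proof -
    have "(\<lambda>h. h \<bullet> g') = (\<lambda>h. h \<bullet> g)"
      using that g unfolding gderiv_def by (rule has_derivative_unique)
    then show ?thesis
      by (metis inner_commute vector_eq_ldot)
  qed
  with g show ?thesis
    unfolding grad_def by (rule theI2)
qed

lemma grad_eqI:
  assumes "GDERIV f x :> g"
  shows "grad f x = g"
proof -
  have "GDERIV f x :> grad f x"
    using assms by (intro GDERIV_grad) (auto simp: gderiv_def differentiable_def)
  then have "(\<lambda>h. h \<bullet> grad f x) = (\<lambda>h. h \<bullet> g)"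
    using assms unfolding gderiv_def by (rule has_derivative_unique)
  then show ?thesis
    by (metis inner_commute vector_eq_ldot)
qed

lemma grad_cong_open:
  assumes "open W" "x \<in> W" "\<And>y. y \<in> W \<Longrightarrow> f y = g y" "g differentiable (at x)"
  shows "grad f x = grad g x" "f differentiable (at x)"
proof -
  have "GDERIV g x :> grad g x"
    using assms by (intro GDERIV_grad)
  then have "GDERIV f x :> grad g x"
    unfolding gderiv_def
    by (rule has_derivative_transform_within_open[OF _ assms(1,2)]) (simp add: assms(3))
  then show "grad f x = grad g x" "f differentiable (at x)"
    by (auto simp: gderiv_def differentiable_def intro: grad_eqI)
qed

lemma C_k_on_differentiable: "C_k_on (Suc k) f S \<Longrightarrow> x \<in> S \<Longrightarrow> f differentiable (at x)"
  by simp

lemma C_k_on_grad: "C_k_on (Suc k) f S \<Longrightarrow> C_k_on k (\<lambda>x. grad f x $ i) S"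
  by simp

lemma C_k_on_continuous_on: "C_k_on k f S \<Longrightarrow> continuous_on S f"
proof (cases k)
  case (Suc m)
  assume "C_k_on k f S"
  with Suc show ?thesis
    by (auto intro!: continuous_at_imp_continuous_on differentiable_imp_continuous_within)
qed simp

lemma C_k_on_subset: "C_k_on k f S \<Longrightarrow> T \<subseteq> S \<Longrightarrow> C_k_on k f T"
  by (induction k arbitrary: f) (auto intro: continuous_on_subset)

lemma grad_differentiable:
  assumes "C_k_on (Suc (Suc k)) f S" "x \<in> S"
  shows "grad f differentiable (at x)"
proof -
  have "(grad f) differentiable (at x within UNIV) \<longleftrightarrow>
      (\<forall>i\<in>Basis. (\<lambda>x. grad f x \<bullet> i) differentiable (at x within UNIV))"
    by (rule differentiable_componentwise_within)
  moreover have "(\<lambda>x. grad f x \<bullet> i) differentiable (at x)" if "i \<in> Basis" for i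
    using assms that by (auto simp: Basis_vec_def inner_axis)
  ultimately show ?thesis
    by simp
qed

text \<open>\<open>C_k_on\<close> speaks of iterated gradients of components, while
  \<open>hess\<close> is a Jacobian matrix. Row \<open>i\<close> of the Jacobian is the gradient of
  component \<open>i\<close>, which links the two.\<close>

lemma hess_component:
  assumes "grad f differentiable (at x)"
  shows "hess f x $ i $ j = grad (\<lambda>x. grad f x $ i) x $ j"
proof -
  have "(grad f has_derivative (\<lambda>h. hess f x *v h)) (at x)"
    using assms by (simp add: jacobian_works hess_def)
  then have "((\<lambda>x. grad f x $ i) has_derivative (\<lambda>h. (hess f x *v h) $ i)) (at x)"
    by (rule bounded_linear.has_derivative[OF bounded_linear_vec_nth])
  also have "(\<lambda>h. (hess f x *v h) $ i) = (\<lambda>h. h \<bullet> hess f x $ i)"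
    by (simp add: matrix_vector_mul_component inner_commute)
  finally have "GDERIV (\<lambda>x. grad f x $ i) x :> hess f x $ i"
    by (simp add: gderiv_def)
  then show ?thesis
    by (simp add: grad_eqI)
qed

text \<open>The base point is the first entry, so it can be recovered from the jet and survives
  passing to limits.\<close>

definition jet_at :: "(real ^ 'n \<Rightarrow> real) \<Rightarrow> real ^ 'n
    \<Rightarrow> (real ^ 'n) \<times> real \<times> (real ^ 'n) \<times> (real ^ 'n ^ 'n)" where
  "jet_at f y = (y, f y, grad f y, hess f y)"

lemma continuous_on_jet_at:
  assumes "C_k_on (Suc (Suc k)) f S"
  shows "continuous_on S (jet_at f)"
proof -
  have 1: "continuous_on S (grad f)"
    using C_k_on_continuous_on[OF C_k_on_grad[OF assms]]
    by (subst continuous_on_componentwise) (auto simp: Basis_vec_def inner_axis)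
  have 2: "continuous_on S (\<lambda>x. grad (\<lambda>x. grad f x $ i) x $ j)" for i j
    using assms by (intro C_k_on_continuous_on[of k] C_k_on_grad)
  have "continuous_on S (\<lambda>x. hess f x $ i $ j)" for i j
    using 2 by (rule continuous_on_eq) (simp add: hess_component grad_differentiable[OF assms])
  then have 3: "continuous_on S (hess f)"
    by (subst continuous_on_componentwise) (auto simp: Basis_vec_def inner_axis)
  show ?thesis
    unfolding jet_at_def using 1 3 C_k_on_continuous_on[OF assms]
    by (intro continuous_intros)
qed

text \<open>Differentiation is local, and \<open>W\<close> is open: the gradients agree throughout
  \<open>W\<close>, hence so do their derivatives at \<open>x\<close>.\<close>

lemma jet_at_cong_open:
  assumes "open W" "x \<in> W" "\<And>y. y \<in> W \<Longrightarrow> f y = g y" "C_k_on (Suc (Suc k)) g W"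
  shows "jet_at f x = jet_at g x" "x \<notin> Omega2 f"
proof -
  have d: "g differentiable (at y)" if "y \<in> W" for y
    using C_k_on_differentiable[OF assms(4) that] .
  have grad: "grad f y = grad g y" "f differentiable (at y)" if "y \<in> W" for y
    using grad_cong_open[OF assms(1) that assms(3) d[OF that]] by auto
  have "(grad g has_derivative (\<lambda>h. hess g x *v h)) (at x)"
    using grad_differentiable[OF assms(4,2)] by (simp add: jacobian_works hess_def)
  then have D: "(grad f has_derivative (\<lambda>h. hess g x *v h)) (at x)"
    by (rule has_derivative_transform_within_open[OF _ assms(1,2)]) (simp add: grad)
  then have "grad f differentiable (at x)"
    by (auto simp: differentiable_def)
  with grad(2) assms(1,2) show "x \<notin> Omega2 f"
    by (auto simp: Omega2_def twice_differentiable_at_def eventually_nhds)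
  have "hess f x = hess g x"
    unfolding hess_def jacobian_def frechet_derivative_at[OF D, symmetric]
    using grad_differentiable[OF assms(4,2)]
    by (simp add: jacobian_works hess_def frechet_derivative_at)
  then show "jet_at f x = jet_at g x"
    using assms(2,3) grad by (simp add: jet_at_def)
qed

section \<open>Finite closed covers and finite maxima\<close>

text \<open>An elementary finite form of Baire's theorem. Either \<open>W\<close> lies in
  \<open>S a\<close>, hence in its interior, or \<open>W - S a\<close> is a nonempty open set
  covered by the remaining sets.\<close>

lemma finite_closed_cover_interior:
  fixes S :: "'k \<Rightarrow> 'a::topological_space set"
  assumes "finite I" "\<And>k. k \<in> I \<Longrightarrow> closed (S k)" "open W" "W \<noteq> {}" "W \<subseteq> (\<Union>k\<in>I. S k)"
  shows "\<exists>k\<in>I. W \<inter> interior (S k) \<noteq> {}"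
  using assms
proof (induction I arbitrary: W rule: finite_induct)
  case (insert a I)
  show ?case
  proof (cases "W \<subseteq> S a")
    case True
    then have "W \<subseteq> interior (S a)"
      using insert.prems by (intro interior_maximal)
    then show ?thesis
      using insert.prems by auto
  next
    case False
    have "\<exists>k\<in>I. (W - S a) \<inter> interior (S k) \<noteq> {}"
      using insert.prems False by (intro insert.IH open_Diff) auto
    then show ?thesis
      by blast
  qed
qed simp

lemma continuous_on_MAX:
  fixes g :: "'k \<Rightarrow> 'a::topological_space \<Rightarrow> 'b::linorder_topology"
  assumes "finite I" "I \<noteq> {}" "\<And>k. k \<in> I \<Longrightarrow> continuous_on S (g k)"
  shows "continuous_on S (\<lambda>x. MAX k\<in>I. g k x)"
  using assms
proof (induction I rule: finite_ne_induct)
  case (insert a I)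
  then show ?case
    by (simp add: continuous_on_max)
qed simp

section \<open>Taylor expansion with cubic remainder\<close>

lemma has_real_derivative_along_line:
  fixes h :: "real ^ 'n \<Rightarrow> real"
  assumes "h differentiable (at (y + t *\<^sub>R v))"
  shows "((\<lambda>t. h (y + t *\<^sub>R v)) has_real_derivative
    (\<Sum>i\<in>UNIV. v $ i * grad h (y + t *\<^sub>R v) $ i)) (at t)"
proof -
  have "((\<lambda>t. y + t *\<^sub>R v) has_derivative (\<lambda>s. s *\<^sub>R v)) (at t)"
    by (auto intro!: derivative_eq_intros)
  moreover have "(h has_derivative (\<lambda>u. u \<bullet> grad h (y + t *\<^sub>R v))) (at (y + t *\<^sub>R v))"
    using GDERIV_grad[OF assms] by (simp add: gderiv_def)
  ultimately have "((\<lambda>t. h (y + t *\<^sub>R v)) has_derivative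
      (\<lambda>s. (s *\<^sub>R v) \<bullet> grad h (y + t *\<^sub>R v))) (at t)"
    by (rule has_derivative_compose)
  also have "(\<lambda>s. (s *\<^sub>R v) \<bullet> grad h (y + t *\<^sub>R v)) =
      (*) (\<Sum>i\<in>UNIV. v $ i * grad h (y + t *\<^sub>R v) $ i)"
    by (auto simp: inner_vec_def sum_distrib_left mult_ac)
  finally show ?thesis
    by (simp only: has_field_derivative_def)
qed

text \<open>Defined on arbitrary tuples, so that limits of jets can be evaluated and continuity in
  the jet makes sense.\<close>

definition quad_eval :: "(real ^ 'n) \<times> real \<times> (real ^ 'n) \<times> (real ^ 'n ^ 'n) \<Rightarrow> real ^ 'n \<Rightarrow> real" where
  "quad_eval p z = (case p of (y, t, \<xi>, H) \<Rightarrow> t + \<xi> \<bullet> (z - y) + 1 / 2 * ((z - y) \<bullet> (H *v (z - y))))"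

text \<open>Maclaurin expansion of \<open>g (y + t *\<^sub>R (z - y))\<close> in \<open>t\<close>,
  taken at \<open>t = 1\<close>: the orders below 3 give the quadratic polynomial, and the remainder
  is the third derivative at an intermediate time divided by 3!.\<close>

lemma taylor_quad_error_along_line:
  fixes g :: "real ^ 'n \<Rightarrow> real"
  assumes "C_k_on 3 g UNIV"
  shows "\<exists>t\<in>{0<..<1}. g z - quad_eval (jet_at g y) z =
    (\<Sum>i\<in>UNIV. \<Sum>j\<in>UNIV. \<Sum>l\<in>UNIV. (z - y) $ i * ((z - y) $ j * ((z - y) $ l *
       grad (\<lambda>x. grad (\<lambda>x. grad g x $ i) x $ j) (y + t *\<^sub>R (z - y)) $ l))) / 6"
proof -
  define v where "v = z - y"
  define c where "c = (\<lambda>t::real. y + t *\<^sub>R v)"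
  have g3: "C_k_on (Suc (Suc (Suc 0))) g UNIV"
    using assms by (simp only: numeral_3_eq_3)
  define D1 where "D1 = (\<lambda>i x. grad g x $ i)"
  define D2 where "D2 = (\<lambda>i j x. grad (D1 i) x $ j)"
  define D3 where "D3 = (\<lambda>i j l x. grad (D2 i j) x $ l)"
  have diff: "g differentiable (at x)" "D1 i differentiable (at x)" "D2 i j differentiable (at x)"
    for x i j using g3 by (auto simp: D1_def D2_def)
  \<comment> \<open>\<open>diff m\<close> is the \<open>m\<close>-th derivative along the line for
    \<open>m\<close> up to 3. The products are nested so that each differentiation only replaces the
    innermost factor.\<close>
  define diff where "diff = (\<lambda>(m::nat) t. if m = 0 then g (c t)
      else if m = 1 then \<Sum>i\<in>UNIV. v $ i * D1 i (c t)
      else if m = 2 then \<Sum>i\<in>UNIV. \<Sum>j\<in>UNIV. v $ i * (v $ j * D2 i j (c t))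
      else \<Sum>i\<in>UNIV. \<Sum>j\<in>UNIV. \<Sum>l\<in>UNIV. v $ i * (v $ j * (v $ l * D3 i j l (c t))))"
  have "DERIV (diff 0) t :> diff 1 t" for t
    using has_real_derivative_along_line[OF diff(1)]
    by (simp add: diff_def c_def D1_def)
  moreover have "DERIV (diff 1) t :> diff 2 t" for t
    using has_real_derivative_along_line[OF diff(2)]
    by (auto simp: diff_def c_def D2_def sum_distrib_left[symmetric] intro!: DERIV_sum DERIV_cmult)
  moreover have "DERIV (diff 2) t :> diff 3 t" for t
    using has_real_derivative_along_line[OF diff(3)]
    by (auto simp: diff_def c_def D3_def sum_distrib_left[symmetric] intro!: DERIV_sum DERIV_cmult)
  ultimately have "\<forall>m t. m < 3 \<and> 0 \<le> t \<and> t \<le> 1 \<longrightarrow> DERIV (diff m) t :> diff (Suc m) t"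
    by (auto simp: less_Suc_eq numeral_3_eq_3 numeral_2_eq_2)
  then obtain t where t: "0 < t" "t < 1"
    and eq: "diff 0 1 = (\<Sum>m<3. (diff m 0 / fact m) * 1 ^ m) + (diff 3 t / fact 3) * 1 ^ 3"
    using Maclaurin[of 1 3 diff "diff 0"] by auto
  have "v \<bullet> (hess g y *v v) = diff 2 0"
    using grad_differentiable[OF g3 UNIV_I, of y]
    by (simp add: inner_vec_def matrix_vector_mult_def diff_def c_def D2_def D1_def
       hess_component sum_distrib_left mult.commute)
  moreover have "grad g y \<bullet> v = diff 1 0"
    by (simp add: diff_def c_def D1_def inner_vec_def mult.commute)
  ultimately have "quad_eval (jet_at g y) z = (\<Sum>m<3. (diff m 0 / fact m) * 1 ^ m)"
    by (simp add: quad_eval_def jet_at_def v_def[symmetric] numeral_3_eq_3 diff_def c_def)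
  moreover have "g z = diff 0 1"
    by (simp add: diff_def c_def v_def)
  ultimately have "g z - quad_eval (jet_at g y) z = diff 3 t / 6"
    using eq by (simp add: fact_numeral)
  with t show ?thesis
    by (intro bexI[of _ t]) (auto simp: diff_def D1_def D2_def D3_def c_def v_def)
qed

text \<open>Convexity keeps the intermediate point in \<open>A\<close>, where compactness bounds the
  continuous third partial derivatives. Each coordinate of \<open>z - y\<close> is at most its
  norm.\<close>

lemma taylor_quad_error_bound:
  fixes g :: "real ^ 'n \<Rightarrow> real"
  assumes "C_k_on 3 g UNIV" "compact A" "convex A"
  shows "\<exists>C\<ge>0. \<forall>y\<in>A. \<forall>z\<in>A. quad_eval (jet_at g y) z - g z \<le> C * norm (z - y) ^ 3"
proof -
  define D3 where "D3 = (\<lambda>i j l x. grad (\<lambda>x. grad (\<lambda>x. grad g x $ i) x $ j) x $ l)"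
  define P where "P = (\<lambda>x. \<Sum>i\<in>UNIV. \<Sum>j\<in>UNIV. \<Sum>l\<in>UNIV. \<bar>D3 i j l x\<bar>)"
  have "continuous_on UNIV (D3 i j l)" for i j l
    using assms(1) by (simp add: D3_def numeral_3_eq_3)
  then have "continuous_on A P"
    unfolding P_def by (intro continuous_intros) (auto intro: continuous_on_subset)
  then have "bounded (P ` A)"
    using assms(2) by (intro compact_imp_bounded compact_continuous_image)
  then obtain B where B: "B > 0" "\<And>x. x \<in> A \<Longrightarrow> \<bar>P x\<bar> \<le> B"
    by (auto simp: bounded_pos)
  have "quad_eval (jet_at g y) z - g z \<le> B * norm (z - y) ^ 3" if "y \<in> A" "z \<in> A" for y z
  proof -
    obtain t where t: "t \<in> {0<..<1}" and eq: "g z - quad_eval (jet_at g y) z =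
      (\<Sum>i\<in>UNIV. \<Sum>j\<in>UNIV. \<Sum>l\<in>UNIV. (z - y) $ i * ((z - y) $ j * ((z - y) $ l *
         D3 i j l (y + t *\<^sub>R (z - y))))) / 6" (is "_ = ?S / 6")
      using taylor_quad_error_along_line[OF assms(1), of z y] unfolding D3_def by blast
    define x where "x = y + t *\<^sub>R (z - y)"
    have "x = (1 - t) *\<^sub>R y + t *\<^sub>R z"
      by (simp add: x_def algebra_simps)
    then have "x \<in> A"
      using assms(3) that t by (simp add: convex_alt)
    have "\<bar>?S\<bar> \<le> (\<Sum>i\<in>UNIV. \<Sum>j\<in>UNIV. \<Sum>l\<in>UNIV. norm (z - y) ^ 3 * \<bar>D3 i j l x\<bar>)"
    proof (intro order_trans[OF sum_abs] sum_mono)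
      fix i j l
      have "\<bar>(z - y) $ i\<bar> * (\<bar>(z - y) $ j\<bar> * (\<bar>(z - y) $ l\<bar> * \<bar>D3 i j l x\<bar>))
        \<le> norm (z - y) * (norm (z - y) * (norm (z - y) * \<bar>D3 i j l x\<bar>))"
        by (intro mult_mono component_le_norm_cart) auto
      then show "\<bar>(z - y) $ i * ((z - y) $ j * ((z - y) $ l * D3 i j l (y + t *\<^sub>R (z - y))))\<bar>
        \<le> norm (z - y) ^ 3 * \<bar>D3 i j l x\<bar>"
        by (simp add: abs_mult x_def[symmetric] power3_eq_cube mult.assoc)
    qed
    also have "\<dots> = norm (z - y) ^ 3 * P x"
      by (simp add: P_def sum_distrib_left)
    also have "\<dots> \<le> norm (z - y) ^ 3 * B"
      using B(2)[OF \<open>x \<in> A\<close>] by (intro mult_left_mono) auto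
    \<comment> \<open>The factor 1/6 of the remainder is simply bounded by 1.\<close>
    finally show ?thesis
      using eq by (simp add: mult.commute)
  qed
  with B(1) show ?thesis
    by (intro exI[of _ B]) auto
qed

section \<open>The model as a maximum of quadratic polynomials\<close>

text \<open>As an image under \<open>quad_eval\<close>, the set has a greatest element as soon as a
  continuous function attains its maximum.\<close>

lemma model_eq: "model f x \<epsilon> z = (GREATEST t. t \<in> (\<lambda>p. quad_eval p z) ` {(y, t, \<xi>, H). t = f y \<and> (y, t, \<xi>, H) \<in> jet2 \<epsilon> f x})"
proof -
  have "{f y + \<xi> \<bullet> (z - y) + 1 / 2 * ((z - y) \<bullet> (H *v (z - y))) | y \<xi> H. (y, f y, \<xi>, H) \<in> jet2 \<epsilon> f x}
    = (\<lambda>p. quad_eval p z) ` {(y, t, \<xi>, H). t = f y \<and> (y, t, \<xi>, H) \<in> jet2 \<epsilon> f x}"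
    by (force simp: quad_eval_def image_iff)
  then show ?thesis
    by (simp add: model_def)
qed

text \<open>Continuity is needed jointly in point and jet, for maximizing over pairs. Writing the
  matrix product in coordinates reduces it to sums and products.\<close>

lemma continuous_on_quad_eval:
  fixes S :: "((real ^ 'n) \<times> (real ^ 'n) \<times> real \<times> (real ^ 'n) \<times> (real ^ 'n ^ 'n)) set"
  shows "continuous_on S (\<lambda>(z, p). quad_eval p z)"
proof -
  have "(\<lambda>(z :: real ^ 'n, p). quad_eval p z) = (\<lambda>q. fst (snd (snd q)) + fst (snd (snd (snd q))) \<bullet> (fst q - fst (snd q))
     + 1 / 2 * (\<Sum>i\<in>UNIV. (fst q - fst (snd q)) $ i *
         (\<Sum>j\<in>UNIV. snd (snd (snd (snd q))) $ i $ j * (fst q - fst (snd q)) $ j)))"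
    by (auto simp: quad_eval_def fun_eq_iff matrix_vector_mult_def inner_vec_def)
  moreover have "continuous_on S \<dots>"
    by (intro continuous_intros)
  ultimately show ?thesis
    by (simp only:)
qed

section \<open>Jets of a finite maximum of C^3 functions\<close>

locale max_of_C3 =
  fixes f :: "real ^ 'n \<Rightarrow> real" and I :: "'k set" and fk :: "'k \<Rightarrow> real ^ 'n \<Rightarrow> real"
  assumes finite_I: "finite I" and I_nonempty: "I \<noteq> {}"
    and C3: "k \<in> I \<Longrightarrow> C_k_on 3 (fk k) UNIV"
    and f_eq: "f x = (MAX k\<in>I. fk k x)"
    and C2: "f differentiable (at x) \<Longrightarrow> C2_at f x"
begin

text \<open>A container for the \<epsilon>-jet, restricted to pieces active at the base point: only
  for them does the jet carry the value of \<open>f\<close>.\<close>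

definition piece_jets :: "(real ^ 'n) set \<Rightarrow> ((real ^ 'n) \<times> real \<times> (real ^ 'n) \<times> (real ^ 'n ^ 'n)) set" where
  "piece_jets A = (\<Union>k\<in>I. jet_at (fk k) ` {y \<in> A. f y = fk k y})"

lemma piece_le: "k \<in> I \<Longrightarrow> fk k x \<le> f x"
  using finite_I by (simp add: f_eq)

lemma active_piece: "\<exists>k\<in>I. f x = fk k x"
proof -
  have "f x \<in> (\<lambda>k. fk k x) ` I"
    unfolding f_eq using finite_I I_nonempty by (intro Max_in) auto
  then show ?thesis
    by auto
qed

lemma continuous_on_piece: "k \<in> I \<Longrightarrow> continuous_on A (fk k)"
  using C_k_on_continuous_on[OF C3] continuous_on_subset by blast

lemma continuous_on_f: "continuous_on A f"
  unfolding f_eq[abs_def]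
  using finite_I I_nonempty continuous_on_piece by (intro continuous_on_MAX)

lemma closed_active: "k \<in> I \<Longrightarrow> closed {y. f y = fk k y}"
  using continuous_on_f continuous_on_piece by (intro closed_Collect_eq)

text \<open>A finite union of continuous images of compact sets, since being active is a closed
  condition.\<close>

lemma compact_piece_jets:
  assumes "compact A"
  shows "compact (piece_jets A)"
  unfolding piece_jets_def
proof (intro compact_UN[OF finite_I] compact_continuous_image)
  fix k assume k: "k \<in> I"
  have "C_k_on (Suc (Suc 1)) (fk k) UNIV"
    using C3[OF k] by (simp only: numeral_3_eq_3 One_nat_def)
  then show "continuous_on {y \<in> A. f y = fk k y} (jet_at (fk k))"
    using continuous_on_jet_at continuous_on_subset by blast
  have "{y \<in> A. f y = fk k y} = A \<inter> {y. f y = fk k y}"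
    by auto
  then show "compact {y \<in> A. f y = fk k y}"
    using assms closed_active[OF k] by (simp add: compact_Int_closed)
qed

text \<open>Points near which one piece represents \<open>f\<close>. Twice differentiability may
  also hold elsewhere, as for \<open>max 0 (x ^ 3)\<close> at 0, so jets at such points are reached
  by density.\<close>

definition regular :: "(real ^ 'n) set" where
  "regular = (\<Union>k\<in>I. interior {y. f y = fk k y})"

lemma regular_jet:
  assumes "y \<in> regular"
  shows "y \<notin> Omega2 f" "y \<in> A \<Longrightarrow> jet_at f y \<in> piece_jets A"
proof -
  obtain k where k: "k \<in> I" "y \<in> interior {y. f y = fk k y}"
    using assms by (auto simp: regular_def)
  have fk: "f x = fk k x" if "x \<in> interior {y. f y = fk k y}" for x
    using that interior_subset[of "{y. f y = fk k y}"] by auto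
  have "C_k_on (Suc (Suc 1)) (fk k) UNIV"
    using C3[OF k(1)] by (simp only: numeral_3_eq_3 One_nat_def)
  then have "C_k_on (Suc (Suc 1)) (fk k) (interior {y. f y = fk k y})"
    by (rule C_k_on_subset) simp
  from jet_at_cong_open[OF open_interior k(2) fk this] fk[OF k(2)] k(1)
  show "y \<notin> Omega2 f" "y \<in> A \<Longrightarrow> jet_at f y \<in> piece_jets A"
    by (auto simp: piece_jets_def)
qed

lemma regular_dense:
  assumes "open W" "W \<noteq> {}"
  shows "W \<inter> regular \<noteq> {}"
proof -
  have "\<exists>k\<in>I. W \<inter> interior {y. f y = fk k y} \<noteq> {}"
    using assms closed_active active_piece
    by (intro finite_closed_cover_interior finite_I) auto
  then show ?thesis
    by (auto simp: regular_def)
qed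

text \<open>Differentiability makes \<open>f\<close> a \<open>C\<^sup>2\<close> function near \<open>y\<close>, so its jet at \<open>y\<close> is a limit of jets at
  regular points, and those lie in a compact set.\<close>

lemma jet_at_in_piece_jets:
  assumes "y \<notin> Omega2 f" "y \<in> A"
  shows "jet_at f y \<in> piece_jets A"
proof -
  have "f differentiable (at y)"
    using assms(1) by (auto simp: Omega2_def twice_differentiable_at_def eventually_nhds)
  then obtain S where S: "open S" "y \<in> S" "C_k_on 2 f S"
    using C2 by (auto simp: C2_at_def)
  \<comment> \<open>The unit ball serves to keep all approximating jets in one compact set,
    whichever pieces they come from.\<close>
  define T where "T = S \<inter> ball y 1 \<inter> regular"
  have "y \<in> closure T"
    unfolding closure_iff_nhds_not_empty
  proof (intro allI impI)
    fix B V assume "V \<subseteq> B" "open V" "y \<in> V"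
    then have "(V \<inter> S \<inter> ball y 1) \<inter> regular \<noteq> {}"
      using S by (intro regular_dense) (auto intro!: exI[of _ y])
    then show "T \<inter> B \<noteq> {}"
      using \<open>V \<subseteq> B\<close> by (auto simp: T_def)
  qed
  then obtain d where d: "\<And>n. d n \<in> T" "d \<longlonglongrightarrow> y"
    by (auto simp: closure_sequential)
  have "C_k_on (Suc (Suc 0)) f S"
    using S(3) by (simp only: numeral_2_eq_2)
  then have "isCont (jet_at f) y"
    using continuous_on_jet_at S continuous_on_eq_continuous_at by blast
  then have "(\<lambda>n. jet_at f (d n)) \<longlonglongrightarrow> jet_at f y"
    using d(2) by (rule isCont_tendsto_compose)
  moreover have "jet_at f (d n) \<in> piece_jets (cball y 1)" for n
    using d(1)[of n] by (intro regular_jet) (auto simp: T_def)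
  moreover have "closed (piece_jets (cball y 1))"
    by (intro compact_imp_closed compact_piece_jets compact_cball)
  ultimately have "jet_at f y \<in> piece_jets (cball y 1)"
    by (metis closed_sequentially)
  \<comment> \<open>The first entry of the jet forces the base point to be \<open>y\<close> itself,
    so the auxiliary ball can be exchanged for \<open>A\<close>.\<close>
  then obtain k where "k \<in> I" "jet_at f y = jet_at (fk k) y" "f y = fk k y"
    by (auto simp: piece_jets_def jet_at_def)
  with assms(2) show ?thesis
    by (auto simp: piece_jets_def)
qed

lemma jet2_eq: "jet2 \<epsilon> f x = (\<Inter>\<delta>\<in>{\<epsilon><..}. closure (jet_at f ` (cball x \<delta> - Omega2 f)))"
  by (simp add: jet2_def jet_at_def[abs_def])

text \<open>For each \<delta> > \<epsilon> the closure stays inside the compact set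
  \<open>piece_jets (cball x \<delta>)\<close>. A jet carries its base point, so all these \<delta>
  constrain the same point, and letting \<delta> decrease to \<epsilon> puts it in the ball of
  radius \<epsilon>.\<close>

lemma jet2_subset: "jet2 \<epsilon> f x \<subseteq> piece_jets (cball x \<epsilon>)"
proof
  fix p assume p: "p \<in> jet2 \<epsilon> f x"
  have *: "p \<in> piece_jets (cball x \<delta>)" if "\<delta> > \<epsilon>" for \<delta>
  proof -
    have "closure (jet_at f ` (cball x \<delta> - Omega2 f)) \<subseteq> piece_jets (cball x \<delta>)"
      using jet_at_in_piece_jets
      by (intro closure_minimal compact_imp_closed compact_piece_jets) auto
    then show ?thesis
      using p that by (auto simp: jet2_eq)
  qed
  \<comment> \<open>Any radius above \<epsilon> would do here: only the index of an active piece is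
    extracted.\<close>
  obtain k where k: "k \<in> I" "p = jet_at (fk k) (fst p)" "f (fst p) = fk k (fst p)"
    using *[of "\<epsilon> + 1"] by (auto simp: piece_jets_def jet_at_def)
  have "dist x (fst p) \<le> \<delta>" if "\<delta> > \<epsilon>" for \<delta>
    using *[OF that] by (auto simp: piece_jets_def jet_at_def)
  then have "dist x (fst p) \<le> \<epsilon>"
    by (rule dense_ge)
  with k(3) have "fst p \<in> {y \<in> cball x \<epsilon>. f y = fk k y}"
    by simp
  then have "jet_at (fk k) (fst p) \<in> piece_jets (cball x \<epsilon>)"
    unfolding piece_jets_def using k(1) by blast
  then show "p \<in> piece_jets (cball x \<epsilon>)"
    by (simp only: k(2)[symmetric])
qed

lemma compact_jet2: "compact (jet2 \<epsilon> f x)"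
proof -
  have "closed (jet2 \<epsilon> f x)"
    by (auto simp: jet2_eq)
  with compact_piece_jets[of "cball x \<epsilon>"] jet2_subset[of \<epsilon> x] show ?thesis
    by (metis compact_Int_closed compact_cball inf.absorb2)
qed

text \<open>By density the open ball contains a regular point, and its jet lies in every set of the
  intersection.\<close>

lemma jet2_nonempty:
  assumes "\<epsilon> > 0"
  shows "jet2 \<epsilon> f x \<noteq> {}"
proof -
  have "ball x \<epsilon> \<inter> regular \<noteq> {}"
    using assms by (intro regular_dense) auto
  then obtain d where d: "d \<in> ball x \<epsilon>" "d \<in> regular"
    by blast
  have "jet_at f d \<in> jet2 \<epsilon> f x"
    unfolding jet2_eq
  proof
    fix \<delta> assume "\<delta> \<in> {\<epsilon><..}"
    with d regular_jet(1)[OF d(2)]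
    have "jet_at f d \<in> jet_at f ` (cball x \<delta> - Omega2 f)" by auto
    then show "jet_at f d \<in> closure (jet_at f ` (cball x \<delta> - Omega2 f))"
      by (rule subsetD[OF closure_subset])
  qed
  then show ?thesis
    by blast
qed

section \<open>Attained maxima and the cubic bound\<close>

lemma model_is_max:
  assumes "\<epsilon> > 0"
  shows "\<exists>p\<in>jet2 \<epsilon> f x. model f x \<epsilon> z = quad_eval p z"
    and "p \<in> jet2 \<epsilon> f x \<Longrightarrow> quad_eval p z \<le> model f x \<epsilon> z"
proof -
  \<comment> \<open>The condition \<open>t = f y\<close> is automatic: jets in the container store
    the value of an active piece.\<close>
  have fib: "{(y, t, \<xi>, H). t = f y \<and> (y, t, \<xi>, H) \<in> jet2 \<epsilon> f x} = jet2 \<epsilon> f x"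
  proof -
    have "fst (snd p) = f (fst p)" if "p \<in> jet2 \<epsilon> f x" for p
      using subsetD[OF jet2_subset that] by (auto simp: piece_jets_def jet_at_def)
    then have "t = f y" if "(y, t, \<xi>, H) \<in> jet2 \<epsilon> f x" for y t \<xi> H
      using that by fastforce
    then show ?thesis
      by auto
  qed
  have "continuous_on (jet2 \<epsilon> f x) ((\<lambda>(z, p). quad_eval p z) \<circ> (\<lambda>p. (z, p)))"
    by (intro continuous_on_compose continuous_on_quad_eval continuous_intros)
  then have "continuous_on (jet2 \<epsilon> f x) (\<lambda>p. quad_eval p z)"
    by (simp add: o_def)
  then obtain q where q: "q \<in> jet2 \<epsilon> f x" "\<And>p. p \<in> jet2 \<epsilon> f x \<Longrightarrow> quad_eval p z \<le> quad_eval q z"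
    using continuous_attains_sup[OF compact_jet2 jet2_nonempty[OF assms]] by blast
  have "model f x \<epsilon> z = quad_eval q z"
    unfolding model_eq fib using q by (intro Greatest_equality) auto
  with q show "\<exists>p\<in>jet2 \<epsilon> f x. model f x \<epsilon> z = quad_eval p z"
    and "p \<in> jet2 \<epsilon> f x \<Longrightarrow> quad_eval p z \<le> model f x \<epsilon> z"
    by auto
qed

text \<open>Continuity of the model in \<open>z\<close> is bypassed:
  \<open>quad_eval p z - f z\<close> is maximized over pairs of a point and a jet. Since the model
  is itself the maximum over jets, the point of an optimal pair maximizes the error.\<close>

lemma model_error_attains_max:
  assumes "\<epsilon> > 0"
  shows "\<exists>z\<in>cball x \<epsilon>. \<forall>w\<in>cball x \<epsilon>. model_error f x \<epsilon> w \<le> model_error f x \<epsilon> z"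
proof -
  have "continuous_on (cball x \<epsilon> \<times> jet2 \<epsilon> f x) (\<lambda>q. (\<lambda>(z, p). quad_eval p z) q - f (fst q))"
    by (intro continuous_on_diff continuous_on_quad_eval continuous_on_compose2[OF continuous_on_f[of UNIV]]
        continuous_intros) auto
  moreover have "compact (cball x \<epsilon> \<times> jet2 \<epsilon> f x)" "cball x \<epsilon> \<times> jet2 \<epsilon> f x \<noteq> {}"
    using compact_jet2 jet2_nonempty[OF assms] assms by (auto intro: compact_Times)
  ultimately have "\<exists>s\<in>cball x \<epsilon> \<times> jet2 \<epsilon> f x. \<forall>q\<in>cball x \<epsilon> \<times> jet2 \<epsilon> f x.
      (\<lambda>(z, p). quad_eval p z) q - f (fst q) \<le> (\<lambda>(z, p). quad_eval p z) s - f (fst s)"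
    by (intro continuous_attains_sup)
  then obtain z p where zp: "z \<in> cball x \<epsilon>" "p \<in> jet2 \<epsilon> f x"
      "\<And>w q. w \<in> cball x \<epsilon> \<Longrightarrow> q \<in> jet2 \<epsilon> f x \<Longrightarrow> quad_eval q w - f w \<le> quad_eval p z - f z"
    by auto
  have "model_error f x \<epsilon> w \<le> model_error f x \<epsilon> z" if "w \<in> cball x \<epsilon>" for w
    using model_is_max(1)[OF assms, of x w] model_is_max(2)[OF assms zp(2), of z] zp(3)[OF that]
    by (fastforce simp: model_error_def)
  with zp(1) show ?thesis
    by blast
qed

text \<open>The model value at \<open>z\<close> comes from a piece active at some \<open>y\<close>
  in the ball. As that piece is at most \<open>f\<close> at \<open>z\<close>, the error is at most
  the Taylor error of the piece, and \<open>y\<close>, \<open>z\<close> are at most 2\<epsilon>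
  apart.\<close>

lemma model_error_bound:
  assumes "bounded A"
  shows "\<exists>K>0. \<forall>x \<epsilon> z. \<epsilon> > 0 \<longrightarrow> cball x \<epsilon> \<subseteq> A \<longrightarrow> z \<in> cball x \<epsilon> \<longrightarrow> model_error f x \<epsilon> z \<le> K * \<epsilon> ^ 3"
proof -
  obtain r where r: "A \<subseteq> cball 0 r"
    using bounded_subset_ballD[OF assms, of 0] ball_subset_cball by (meson order_trans)
  have "\<forall>k\<in>I. \<exists>C\<ge>0. \<forall>y\<in>cball 0 r. \<forall>z\<in>cball 0 r.
      quad_eval (jet_at (fk k) y) z - fk k z \<le> C * norm (z - y) ^ 3"
    using C3 by (intro ballI taylor_quad_error_bound) auto
  then obtain C where C: "\<And>k. k \<in> I \<Longrightarrow> C k \<ge> 0"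
    "\<And>k y z. k \<in> I \<Longrightarrow> y \<in> cball 0 r \<Longrightarrow> z \<in> cball 0 r \<Longrightarrow>
      quad_eval (jet_at (fk k) y) z - fk k z \<le> C k * norm (z - y) ^ 3"
    by metis
  \<comment> \<open>The constants are nonnegative, so their sum dominates each of them.\<close>
  define L where "L = (\<Sum>k\<in>I. C k)"
  have "L \<ge> 0"
    using C(1) by (auto simp: L_def intro: sum_nonneg)
  \<comment> \<open>The 8 is the cube of the 2 in 2\<epsilon>; adding 1 makes the constant positive
    even if \<open>L = 0\<close>.\<close>
  have "model_error f x \<epsilon> z \<le> (8 * L + 1) * \<epsilon> ^ 3"
    if x: "\<epsilon> > 0" "cball x \<epsilon> \<subseteq> A" "z \<in> cball x \<epsilon>" for x \<epsilon> z
  proof -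
    obtain p where "p \<in> jet2 \<epsilon> f x" "model f x \<epsilon> z = quad_eval p z"
      using model_is_max(1)[OF x(1)] by blast
    then obtain k y where k: "k \<in> I" "y \<in> cball x \<epsilon>" "model f x \<epsilon> z = quad_eval (jet_at (fk k) y) z"
      using jet2_subset[of \<epsilon> x] by (auto simp: piece_jets_def)
    have "dist y z \<le> 2 * \<epsilon>"
      using k(2) x(3) dist_triangle[of y z x] by (simp add: dist_commute)
    then have "norm (z - y) \<le> 2 * \<epsilon>"
      by (simp add: dist_norm norm_minus_commute)
    then have "norm (z - y) ^ 3 \<le> 8 * \<epsilon> ^ 3"
      using power_mono[of "norm (z - y)" "2 * \<epsilon>" 3] by (simp add: power_mult_distrib)
    moreover have "C k \<le> L"
      unfolding L_def using finite_I k(1) C(1) by (intro member_le_sum) auto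
    ultimately have "C k * norm (z - y) ^ 3 \<le> L * (8 * \<epsilon> ^ 3)"
      using \<open>L \<ge> 0\<close> by (intro mult_mono) auto
    moreover have "model_error f x \<epsilon> z \<le> C k * norm (z - y) ^ 3"
      using C(2)[of k y z] k x r piece_le[of k z] by (auto simp: model_error_def subset_iff)
    ultimately show ?thesis
      using x(1) by (simp add: algebra_simps) (smt (verit) zero_less_power)
  qed
  with \<open>L \<ge> 0\<close> show ?thesis
    by (intro exI[of _ "8 * L + 1"]) auto
qed

end

theorem lemma7:
  fixes f :: "real ^ 'n \<Rightarrow> real" and I :: "'k set" and fk :: "'k \<Rightarrow> real ^ 'n \<Rightarrow> real"
    and U :: "(real ^ 'n) set" and \<epsilon>' :: real
  assumes "finite I" and "I \<noteq> {}"
    and "\<And>k. k \<in> I \<Longrightarrow> C_k_on 3 (fk k) UNIV"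
    and "\<And>x. f x = (MAX k\<in>I. fk k x)"
    and "\<And>x. f differentiable (at x) \<Longrightarrow> C2_at f x"
    and "bounded U" and "\<epsilon>' > 0"
  shows "\<exists>K>0. \<forall>x\<in>U. \<forall>\<epsilon>\<in>{0<..\<epsilon>'}.
           (GREATEST r. r \<in> model_error f x \<epsilon> ` cball x \<epsilon>) \<le> K * \<epsilon> ^ 3"
proof -
  interpret max_of_C3 f I fk
    using assms(1-5) by unfold_locales
  obtain r where r: "U \<subseteq> cball 0 r"
    using bounded_subset_ballD[OF assms(6), of 0] ball_subset_cball by (meson order_trans)
  \<comment> \<open>One ball contains every \<open>cball x \<epsilon>\<close> with \<open>x\<close>
    in \<open>U\<close> and \<epsilon> at most \<open>\<epsilon>'\<close>, which makes
    \<open>K\<close> uniform.\<close>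
  obtain K where K: "K > 0" "\<And>x \<epsilon> z. \<epsilon> > 0 \<Longrightarrow> cball x \<epsilon> \<subseteq> cball 0 (r + \<epsilon>') \<Longrightarrow> z \<in> cball x \<epsilon> \<Longrightarrow>
      model_error f x \<epsilon> z \<le> K * \<epsilon> ^ 3"
    using model_error_bound[of "cball 0 (r + \<epsilon>')"] by auto
  have "(GREATEST r. r \<in> model_error f x \<epsilon> ` cball x \<epsilon>) \<le> K * \<epsilon> ^ 3"
    if "x \<in> U" and \<epsilon>: "\<epsilon> \<in> {0<..\<epsilon>'}" for x \<epsilon>
  proof -
    have "dist 0 x \<le> r"
      using r that(1) by auto
    then have sub: "cball x \<epsilon> \<subseteq> cball 0 (r + \<epsilon>')"
      using \<epsilon> by (simp add: cball_subset_cball_iff dist_commute)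
    obtain z where z: "z \<in> cball x \<epsilon>"
        "\<And>w. w \<in> cball x \<epsilon> \<Longrightarrow> model_error f x \<epsilon> w \<le> model_error f x \<epsilon> z"
      using model_error_attains_max[of \<epsilon> x] \<epsilon> by auto
    then have "(GREATEST r. r \<in> model_error f x \<epsilon> ` cball x \<epsilon>) = model_error f x \<epsilon> z"
      by (intro Greatest_equality) auto
    with K(2)[OF _ sub z(1)] \<epsilon> show ?thesis
      by simp
  qed
  with K(1) show ?thesis
    by blast
qed

end
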